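(* Let $N$ be a renewal process. For $p\in(0,1)$ let $N=N_1(p)+N_2(p)$ be the decomposition of $N$ determined by an indicator process $X(p)$ that is a Bernoulli$(p)$ process independent of $N$. Then there exists some $p\in(0,1)$ such that $N_1(p)$ is a renewal process with inter-arrival time distribution of the same type as that of $N$ if and only if the inter-arrival time distribution of $N$ is semi-Mittag-Leffler. Likewise, there exists some $p\in(0,1)$ such that $N_2(p)$ is a renewal process with inter-arrival time distribution of the same type as that of $N$ if and only if the inter-arrival time distribution of $N$ is semi-Mittag-Leffler.
   Context: A renewal process is a point process on $(0,\infty)$ with points $t_1<t_2<\cdots$ such that $t_1,t_2-t_1,t_3-t_2,\dots$ are i.i.d. positive random variables (the inter-arrival times). Indicator process: if $t_1<t_2<\cdots$ are the points of $N=N_1+N_2$ (with $N_1,N_2$ having no common points), the indicator process is $X=\{X_1,X_2,\dots\}$, where $X_n=k$ iff $t_n$ is a point of $N_k$, $k=1,2$. Thus $N_1$ consists of the points $t_n$ with $X_n=1$ and $N_2$ of those with $X_n=2$. $X(p)$ being Bernoulli$(p)$ means that the $X_n$ are i.i.d. with $P(X_n=1)=p$ and $P(X_n=2)=1-p$. Two distributions on $[0,\infty)$ are of the same type if they differ only by a change of scale: their Laplace transforms satisfy $\phi_1(s)=\phi(cs)$ for all $s\ge0$, for some $c>0$. A distribution on $[0,\infty)$ is semi-Mittag-Leffler if its Laplace transform has the form $\phi(s)=1/[1+\psi(s)]$ with $\psi(0)=0$ and $\psi(s)=a\,\psi(bs)$ for all $s\ge 0$, for some $0<b<1<a$ with $ab^{\alpha}=1$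 for some $0<\alpha\le 1$. *)

theory Defs
  imports "HOL-Probability.Probability"
begin

text \<open>
  A simple point process on \<open>(0,\<infinity>)\<close> is represented by its random set of points
  \<open>N :: 'a \<Rightarrow> real set\<close>. Points are numbered from \<open>0\<close>: \<open>t n\<close> is the
  \<open>(n+1)\<close>-st point, and \<open>t 0\<close> is itself the first inter-arrival time.
\<close>

definition interarrival :: "(nat \<Rightarrow> 'a \<Rightarrow> real) \<Rightarrow> nat \<Rightarrow> 'a \<Rightarrow> real" where
  "interarrival t n \<omega> = (if n = 0 then t 0 \<omega> else t n \<omega> - t (n - 1) \<omega>)"

text \<open>
  \<open>N\<close> is a renewal process with points \<open>t 0 < t 1 < \<dots>\<close> and inter-arrival time distribution
  \<open>\<mu>\<close>. Pathwise conditions are required almost surely: a component of a Bernoulli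
  decomposition may have only finitely many points on an event of probability zero.
\<close>

definition renewal_process_with_points ::
    "'a measure \<Rightarrow> ('a \<Rightarrow> real set) \<Rightarrow> (nat \<Rightarrow> 'a \<Rightarrow> real) \<Rightarrow> real measure \<Rightarrow> bool" where
  "renewal_process_with_points M N t \<mu> \<longleftrightarrow>
     (AE \<omega> in M. N \<omega> = range (\<lambda>n. t n \<omega>)) \<and>
     prob_space.indep_vars M (\<lambda>_. borel) (interarrival t) UNIV \<and>
     (\<forall>n. distr M borel (interarrival t n) = \<mu>) \<and>
     (\<forall>n. AE \<omega> in M. 0 < interarrival t n \<omega>)"

definition renewal_process :: "'a measure \<Rightarrow> ('a \<Rightarrow> real set) \<Rightarrow> real measure \<Rightarrow> bool" where
  "renewal_process M N \<mu> \<longleftrightarrow> (\<exists>t. renewal_process_with_points M N t \<mu>)"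

definition bernoulli_process :: "'a measure \<Rightarrow> real \<Rightarrow> (nat \<Rightarrow> 'a \<Rightarrow> nat) \<Rightarrow> bool" where
  "bernoulli_process M p X \<longleftrightarrow>
     prob_space.indep_vars M (\<lambda>_. count_space UNIV) X UNIV \<and>
     (\<forall>n. measure M {\<omega> \<in> space M. X n \<omega> = 1} = p \<and>
          measure M {\<omega> \<in> space M. X n \<omega> = 2} = 1 - p)"

text \<open>The random sequences \<open>t\<close> and \<open>X\<close>, each taken as a whole, are independent.\<close>

definition indep_processes ::
    "'a measure \<Rightarrow> (nat \<Rightarrow> 'a \<Rightarrow> real) \<Rightarrow> (nat \<Rightarrow> 'a \<Rightarrow> nat) \<Rightarrow> bool" where
  "indep_processes M t X \<longleftrightarrow>
     prob_space.indep_var M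
       (\<Pi>\<^sub>M n\<in>UNIV. borel) (\<lambda>\<omega> n. t n \<omega>)
       (\<Pi>\<^sub>M n\<in>UNIV. count_space UNIV) (\<lambda>\<omega> n. X n \<omega>)"

definition component ::
    "(nat \<Rightarrow> 'a \<Rightarrow> real) \<Rightarrow> (nat \<Rightarrow> 'a \<Rightarrow> nat) \<Rightarrow> nat \<Rightarrow> 'a \<Rightarrow> real set" where
  "component t X k \<omega> = {t n \<omega> | n. X n \<omega> = k}"

definition nonneg_distribution :: "real measure \<Rightarrow> bool" where
  "nonneg_distribution \<mu> \<longleftrightarrow> real_distribution \<mu> \<and> (AE x in \<mu>. 0 \<le> x)"

definition laplace_transform :: "real measure \<Rightarrow> real \<Rightarrow> real" where
  "laplace_transform \<mu> s = (\<integral>x. exp (- (s * x)) \<partial>\<mu>)"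

definition same_type :: "real measure \<Rightarrow> real measure \<Rightarrow> bool" where
  "same_type \<mu>1 \<mu> \<longleftrightarrow> nonneg_distribution \<mu>1 \<and> nonneg_distribution \<mu> \<and>
     (\<exists>c>0. \<forall>s\<ge>0. laplace_transform \<mu>1 s = laplace_transform \<mu> (c * s))"

definition semi_mittag_leffler :: "real measure \<Rightarrow> bool" where
  "semi_mittag_leffler \<mu> \<longleftrightarrow> nonneg_distribution \<mu> \<and>
     (\<exists>\<psi> :: real \<Rightarrow> real.
        (\<forall>s\<ge>0. laplace_transform \<mu> s = 1 / (1 + \<psi> s)) \<and> \<psi> 0 = 0 \<and>
        (\<exists>a b \<alpha>. 0 < b \<and> b < 1 \<and> 1 < a \<and> 0 < \<alpha> \<and> \<alpha> \<le> 1 \<and> a * b powr \<alpha> = 1 \<and>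
           (\<forall>s\<ge>0. \<psi> s = a * \<psi> (b * s))))"

end

theory Submission
  imports Defs
begin

text \<open>
  Let \<open>\<phi>\<close> be the Laplace transform of the inter-arrival time. After each kept point the marked process
  starts afresh, so a component that keeps points with probability \<open>q\<close> is a renewal process; splitting
  according to the mark of the first point, the transform \<open>L\<close> of its inter-arrival time satisfies
  \<open>L = q \<phi> + (1 - q) \<phi> L\<close>. In terms of \<open>\<psi> = 1 / \<phi> - 1\<close> this is multiplication of \<open>\<psi>\<close> by \<open>1 / q\<close>, so
  invariance up to a scale \<open>c\<close> means \<open>\<psi> (c s) = \<psi> s / q\<close>, the semi-Mittag-Leffler equation with \<open>a = 1 / q\<close>
  and \<open>b = 1 / c\<close>. Monotonicity of \<open>\<phi>\<close> gives \<open>b < 1\<close> and its convexity gives \<open>\<alpha> \<le> 1\<close>.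
\<close>

section \<open>Laplace transforms\<close>

lemma nonneg_distributionI:
  "real_distribution \<mu> \<Longrightarrow> AE x in \<mu>. 0 < x \<Longrightarrow> nonneg_distribution \<mu>"
  unfolding nonneg_distribution_def by (auto elim: eventually_mono)

context
  fixes \<mu> :: "real measure"
  assumes nonneg: "nonneg_distribution \<mu>"
begin

interpretation real_distribution \<mu>
  using nonneg by (simp add: nonneg_distribution_def)

lemma AE_exp_le_1: "0 \<le> s \<Longrightarrow> AE x in \<mu>. exp (- (s * x)) \<le> 1"
  using nonneg by (auto simp: nonneg_distribution_def elim: eventually_mono)

lemma integrable_laplace: "0 \<le> s \<Longrightarrow> integrable \<mu> (\<lambda>x. exp (- (s * x)))"
  using AE_exp_le_1[of s] by (intro integrable_const_bound[where B=1]) auto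

lemma laplace_0: "laplace_transform \<mu> 0 = 1"
  using prob_space by (simp add: laplace_transform_def)

lemma laplace_pos: "0 < laplace_transform \<mu> s" if "0 \<le> s"
proof -
  have "laplace_transform \<mu> s \<noteq> 0"
  proof
    assume "laplace_transform \<mu> s = 0"
    then have "AE x in \<mu>. exp (- (s * x)) = 0"
      unfolding laplace_transform_def
      by (subst (asm) integral_nonneg_eq_0_iff_AE) (auto simp: integrable_laplace that)
    then show False by simp
  qed
  moreover have "0 \<le> laplace_transform \<mu> s"
    unfolding laplace_transform_def by (rule integral_nonneg_AE) simp
  ultimately show ?thesis by simp
qed

lemma laplace_le_1: "0 \<le> s \<Longrightarrow> laplace_transform \<mu> s \<le> 1"
  unfolding laplace_transform_def
  by (intro integral_le_const integrable_laplace AE_exp_le_1)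

text \<open>If the transform were 1, the nonnegative function \<open>1 - exp (- (s * x))\<close>
  would integrate to 0 and so vanish almost everywhere, against \<open>0 < x\<close>.\<close>

lemma laplace_less_1:
  assumes "AE x in \<mu>. 0 < x" "0 < s"
  shows "laplace_transform \<mu> s < 1"
proof -
  have "laplace_transform \<mu> s \<noteq> 1"
  proof
    assume "laplace_transform \<mu> s = 1"
    then have "(\<integral>x. 1 - exp (- (s * x)) \<partial>\<mu>) = 0"
      using assms prob_space by (simp add: laplace_transform_def integrable_laplace)
    moreover have "AE x in \<mu>. 0 \<le> 1 - exp (- (s * x))"
      using AE_exp_le_1[of s] assms(2) by (auto elim: eventually_mono)
    ultimately have "AE x in \<mu>. 1 - exp (- (s * x)) = 0"
      using assms(2) by (subst (asm) integral_nonneg_eq_0_iff_AE) (auto simp: integrable_laplace)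
    with assms(1) have "AE x in \<mu>. False"
      by eventually_elim (use assms(2) in auto)
    then show False by simp
  qed
  then show ?thesis
    using laplace_le_1[of s] assms by simp
qed

lemma laplace_antimono:
  assumes "0 \<le> s" "s \<le> s'"
  shows "laplace_transform \<mu> s' \<le> laplace_transform \<mu> s"
  unfolding laplace_transform_def
proof (rule integral_mono_AE)
  have "AE x in \<mu>. 0 \<le> x"
    using nonneg by (simp add: nonneg_distribution_def)
  then show "AE x in \<mu>. exp (- (s' * x)) \<le> exp (- (s * x))"
    by eventually_elim (use assms in \<open>auto intro: mult_right_mono\<close>)
qed (use assms in \<open>auto intro: integrable_laplace\<close>)

text \<open>Convexity of \<open>exp\<close>: the point \<open>- (b * s * x)\<close> is the mean of
  \<open>0\<close> and \<open>- (s * x)\<close> with weight \<open>b\<close> on the latter.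
  Integrated, this says that \<open>1 - laplace_transform \<mu>\<close> decays at most linearly
  towards the origin, the source of \<open>\<alpha> \<le> 1\<close>.\<close>

lemma laplace_scale:
  assumes "0 \<le> b" "b \<le> 1" "0 \<le> s"
  shows "b * (1 - laplace_transform \<mu> s) \<le> 1 - laplace_transform \<mu> (b * s)"
proof -
  have "exp (- (b * s * x)) \<le> 1 - b + b * exp (- (s * x))" for x :: real
    using convex_onD[OF exp_convex, of b 0 "- (s * x)"] assms by (simp add: algebra_simps)
  then have "laplace_transform \<mu> (b * s) \<le> (\<integral>x. 1 - b + b * exp (- (s * x)) \<partial>\<mu>)"
    unfolding laplace_transform_def using assms
    by (intro integral_mono) (auto intro!: integrable_laplace)
  also have "\<dots> = 1 - b + b * laplace_transform \<mu> s"
    using assms prob_space by (simp add: integrable_laplace laplace_transform_def)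
  finally show ?thesis
    by (simp add: algebra_simps)
qed

text \<open>The analytic half of the theorem: the fraction on the right is the transform of the
  thinned inter-arrival time, see \<open>laplace_waiting_law\<close>. From left to right the
  witnesses are \<open>q = 1 / a\<close> and \<open>c = 1 / b\<close>; from right to left the work
  lies in the bounds on \<open>b\<close> and \<open>\<alpha>\<close>.\<close>

lemma semi_mittag_leffler_iff_thinning_invariant:
  assumes pos: "AE x in \<mu>. 0 < x"
  defines "\<phi> \<equiv> laplace_transform \<mu>"
  shows "semi_mittag_leffler \<mu> \<longleftrightarrow>
    (\<exists>q. 0 < q \<and> q < 1 \<and> (\<exists>c>0. \<forall>s\<ge>0. q * \<phi> s / (1 - (1 - q) * \<phi> s) = \<phi> (c * s)))"
proof
  assume "semi_mittag_leffler \<mu>"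
  then obtain \<psi> a b where \<psi>: "\<And>s. 0 \<le> s \<Longrightarrow> \<phi> s = 1 / (1 + \<psi> s)"
    and ab: "0 < b" "b < 1" "1 < a" and scale: "\<And>s. 0 \<le> s \<Longrightarrow> \<psi> s = a * \<psi> (b * s)"
    unfolding semi_mittag_leffler_def \<phi>_def by blast
  have "1 / a * \<phi> s / (1 - (1 - 1 / a) * \<phi> s) = \<phi> (1 / b * s)" if "0 \<le> s" for s
  proof -
    have s': "0 \<le> 1 / b * s"
      using that ab by simp
    have \<psi>': "\<psi> (1 / b * s) = a * \<psi> s"
      using scale[OF s'] ab by simp
    \<comment> \<open>\<open>\<psi>\<close> is known only through
      \<open>\<phi> = 1 / (1 + \<psi>)\<close>, so the signs of both denominators come from the
      positivity of \<open>\<phi>\<close>.\<close>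
    have "0 < \<phi> s" "0 < \<phi> (1 / b * s)"
      using laplace_pos[OF that] laplace_pos[OF s'] by (simp_all add: \<phi>_def)
    then have *: "0 < 1 + \<psi> s" "0 < 1 + a * \<psi> s"
      using \<psi>[OF that] \<psi>[OF s'] \<psi>' by (simp_all add: zero_less_divide_iff)
    have "1 - (1 - 1 / a) * (1 / (1 + \<psi> s)) = (1 + a * \<psi> s) / (a * (1 + \<psi> s))"
      using * ab by (simp add: field_simps)
    then show ?thesis
      using * ab unfolding \<psi>[OF that] \<psi>[OF s'] \<psi>' by simp
  qed
  then show "\<exists>q. 0 < q \<and> q < 1 \<and> (\<exists>c>0. \<forall>s\<ge>0. q * \<phi> s / (1 - (1 - q) * \<phi> s) = \<phi> (c * s))"
    using ab by (intro exI[of _ "1 / a"] conjI exI[of _ "1 / b"]) auto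
next
  assume "\<exists>q. 0 < q \<and> q < 1 \<and> (\<exists>c>0. \<forall>s\<ge>0. q * \<phi> s / (1 - (1 - q) * \<phi> s) = \<phi> (c * s))"
  then obtain q c where q: "0 < q" "q < 1" and "0 < c"
    and eq: "\<And>s. 0 \<le> s \<Longrightarrow> q * \<phi> s / (1 - (1 - q) * \<phi> s) = \<phi> (c * s)"
    by blast
  define \<psi> where "\<psi> s = 1 / \<phi> s - 1" for s
  define a b where "a = 1 / q" and "b = 1 / c"
  have "1 < a" "0 < b"
    using q \<open>0 < c\<close> by (simp_all add: a_def b_def)
  have \<phi>_pos: "0 < \<phi> s" if "0 \<le> s" for s
    using laplace_pos[OF that] by (simp add: \<phi>_def)
  have "\<psi> (c * s) = a * \<psi> s" if "0 \<le> s" for s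
    unfolding \<psi>_def eq[OF that, symmetric] a_def
    using \<phi>_pos[OF that] q by (simp add: field_simps)
  from this[of "b * s" for s] have scale: "\<psi> s = a * \<psi> (b * s)" if "0 \<le> s" for s
    using that \<open>0 < b\<close> \<open>0 < c\<close> by (simp add: b_def)
  have \<psi>1: "0 < \<psi> 1" and \<phi>1: "\<phi> 1 < 1"
    using laplace_less_1[OF pos, of 1] \<phi>_pos[of 1] by (simp_all add: \<psi>_def \<phi>_def)
  \<comment> \<open>If \<open>1 \<le> b\<close>, monotonicity would give
    \<open>\<psi> 1 \<le> \<psi> b < a * \<psi> b = \<psi> 1\<close>.\<close>
  have "b < 1"
  proof (rule ccontr)
    assume "\<not> b < 1"
    then have "\<phi> b \<le> \<phi> 1"
      unfolding \<phi>_def by (intro laplace_antimono) auto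
    then have "\<psi> 1 \<le> \<psi> b"
      using \<phi>_pos[of b] \<open>0 < b\<close> by (simp add: \<psi>_def frac_le)
    moreover have "\<psi> b < a * \<psi> b"
      using \<open>1 < a\<close> \<psi>1 calculation by simp
    ultimately show False
      using scale[of 1] by simp
  qed
  \<comment> \<open>Convexity makes \<open>(1 - \<phi> s) / s\<close> decreasing, so \<open>\<psi> (b ^ n) = \<psi> 1 / a ^ n\<close> is at least of order \<open>b ^ n\<close>.\<close>
  have "a * b \<le> 1"
  proof (rule ccontr)
    assume "\<not> a * b \<le> 1"
    then obtain n where n: "\<psi> 1 / (1 - \<phi> 1) < (a * b) ^ n"
      using real_arch_pow[of "a * b"] by auto
    have pow: "a ^ n * \<psi> (b ^ n) = \<psi> 1" for n
    proof (induction n)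
      case (Suc n)
      then show ?case
        using scale[of "b ^ n"] \<open>0 < b\<close> by (simp add: mult_ac)
    qed simp
    have "b ^ n * (1 - \<phi> 1) \<le> 1 - \<phi> (b ^ n)"
      using laplace_scale[of "b ^ n" 1] \<open>0 < b\<close> \<open>b < 1\<close> by (simp add: \<phi>_def power_le_one)
    also have "\<dots> \<le> (1 - \<phi> (b ^ n)) / \<phi> (b ^ n)"
      using \<phi>_pos[of "b ^ n"] laplace_le_1[of "b ^ n"] \<open>0 < b\<close>
      by (simp add: \<phi>_def pos_le_divide_eq mult_left_le)
    also have "\<dots> = \<psi> (b ^ n)"
      using \<phi>_pos[of "b ^ n"] \<open>0 < b\<close> by (simp add: \<psi>_def diff_divide_distrib)
    finally have "a ^ n * (b ^ n * (1 - \<phi> 1)) \<le> \<psi> 1"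
      unfolding pow[of n, symmetric] using \<open>1 < a\<close> by (intro mult_left_mono) auto
    then have "(a * b) ^ n \<le> \<psi> 1 / (1 - \<phi> 1)"
      using \<phi>1 by (simp add: pos_le_divide_eq power_mult_distrib mult.assoc)
    with n show False by simp
  qed
  \<comment> \<open>The exponent solves \<open>a = c powr \<alpha>\<close>, which is
    \<open>a * b powr \<alpha> = 1\<close>; the bound \<open>\<alpha> \<le> 1\<close> amounts to
    \<open>a \<le> c\<close>, that is \<open>a * b \<le> 1\<close>.\<close>
  define \<alpha> where "\<alpha> = ln a / ln c"
  have "1 < c"
    using \<open>b < 1\<close> \<open>0 < c\<close> by (simp add: b_def)
  have "a \<le> c"
    using \<open>a * b \<le> 1\<close> \<open>0 < c\<close> by (simp add: b_def)
  then have "0 < \<alpha>" "\<alpha> \<le> 1"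
    using \<open>1 < c\<close> \<open>1 < a\<close> by (simp_all add: \<alpha>_def)
  moreover have "a * b powr \<alpha> = 1"
    using \<open>1 < c\<close> \<open>1 < a\<close>
    by (simp add: \<alpha>_def b_def powr_def ln_div exp_minus)
  moreover have "laplace_transform \<mu> s = 1 / (1 + \<psi> s)" for s
    by (simp add: \<psi>_def \<phi>_def)
  moreover have "\<psi> 0 = 0"
    by (simp add: \<psi>_def \<phi>_def laplace_0)
  ultimately show "semi_mittag_leffler \<mu>"
    unfolding semi_mittag_leffler_def
    using nonneg \<open>1 < a\<close> \<open>0 < b\<close> \<open>b < 1\<close> scale by blast
qed

end

section \<open>Independence of sequences\<close>

text \<open>Turns cylinder sets into events of single coordinates, so that independence of whole
  families can be applied to finitely many variables. \<open>J\<close> is nonempty because an empty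
  intersection would be \<open>UNIV\<close> instead of \<open>space N\<close>.\<close>

lemma vimage_restrict_prod_emb:
  assumes J: "J \<subseteq> I" "J \<noteq> {}" and X: "\<And>i. i \<in> I \<Longrightarrow> X i \<in> measurable N (M i)"
  shows "(\<lambda>\<omega>. \<lambda>i\<in>I. X i \<omega>) -` prod_emb I M J (Pi\<^sub>E J A) \<inter> space N =
    (\<Inter>i\<in>J. X i -` A i \<inter> space N)"
proof (rule set_eqI)
  fix \<omega>
  show "\<omega> \<in> (\<lambda>\<omega>. \<lambda>i\<in>I. X i \<omega>) -` prod_emb I M J (Pi\<^sub>E J A) \<inter> space N \<longleftrightarrow>
    \<omega> \<in> (\<Inter>i\<in>J. X i -` A i \<inter> space N)"
  proof (cases "\<omega> \<in> space N")
    case True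
    then have "(\<lambda>i\<in>I. X i \<omega>) \<in> (\<Pi>\<^sub>E i\<in>I. space (M i))"
      using measurable_space[OF X] by (simp add: restrict_PiE_iff)
    moreover have "restrict (\<lambda>i\<in>I. X i \<omega>) J \<in> Pi\<^sub>E J A \<longleftrightarrow> (\<forall>i\<in>J. X i \<omega> \<in> A i)"
      using J(1) unfolding restrict_PiE_iff by (auto simp: subset_iff)
    ultimately show ?thesis
      using True J(2) by (auto simp: prod_emb_def)
  qed (use J in auto)
qed

text \<open>Independence is checked on rectangles, an Int-stable generator of the pair
  sigma-algebra. Independence of the two families from each other is spelled out as a product rule
  because \<open>indep_var\<close> would force both to have the same value type.\<close>

lemma (in prob_space) indep_vars_Pair:
  assumes X: "indep_vars M1 X I" and Y: "indep_vars M2 Y I"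
    and XY: "\<And>A B. A \<in> sets (PiM I M1) \<Longrightarrow> B \<in> sets (PiM I M2) \<Longrightarrow>
      prob (((\<lambda>\<omega>. \<lambda>i\<in>I. X i \<omega>) -` A \<inter> space M) \<inter> ((\<lambda>\<omega>. \<lambda>i\<in>I. Y i \<omega>) -` B \<inter> space M)) =
      prob ((\<lambda>\<omega>. \<lambda>i\<in>I. X i \<omega>) -` A \<inter> space M) * prob ((\<lambda>\<omega>. \<lambda>i\<in>I. Y i \<omega>) -` B \<inter> space M)"
  shows "indep_vars (\<lambda>i. M1 i \<Otimes>\<^sub>M M2 i) (\<lambda>i \<omega>. (X i \<omega>, Y i \<omega>)) I"
proof -
  have rvX: "random_variable (M1 i) (X i)" and rvY: "random_variable (M2 i) (Y i)" if "i \<in> I" for i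
    using X Y that by (auto simp: indep_vars_def2)
  define E where "E i = {(X i -` A \<inter> space M) \<inter> (Y i -` B \<inter> space M) | A B.
      A \<in> sets (M1 i) \<and> B \<in> sets (M2 i)}" for i
  have E_iff: "G \<in> E i \<longleftrightarrow> (\<exists>A B. A \<in> sets (M1 i) \<and> B \<in> sets (M2 i) \<and>
      G = (X i -` A \<inter> space M) \<inter> (Y i -` B \<inter> space M))" for G i
    unfolding E_def by blast
  \<comment> \<open>\<open>XY\<close> on cylinder sets separates the \<open>X\<close> part from the
    \<open>Y\<close> part; each part then factors by its own independence.\<close>
  have joint: "prob (\<Inter>i\<in>J. (X i -` A i \<inter> space M) \<inter> (Y i -` B i \<inter> space M)) =
      (\<Prod>i\<in>J. prob (X i -` A i \<inter> space M) * prob (Y i -` B i \<inter> space M))"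
    if J: "J \<subseteq> I" "J \<noteq> {}" "finite J" and A: "\<And>i. i \<in> J \<Longrightarrow> A i \<in> sets (M1 i)"
      and B: "\<And>i. i \<in> J \<Longrightarrow> B i \<in> sets (M2 i)" for J A B
  proof -
    have preX: "(\<lambda>\<omega>. \<lambda>i\<in>I. X i \<omega>) -` prod_emb I M1 J (Pi\<^sub>E J A) \<inter> space M =
        (\<Inter>i\<in>J. X i -` A i \<inter> space M)"
      using J rvX by (intro vimage_restrict_prod_emb) auto
    have preY: "(\<lambda>\<omega>. \<lambda>i\<in>I. Y i \<omega>) -` prod_emb I M2 J (Pi\<^sub>E J B) \<inter> space M =
        (\<Inter>i\<in>J. Y i -` B i \<inter> space M)"
      using J rvY by (intro vimage_restrict_prod_emb) auto
    have "(\<Inter>i\<in>J. (X i -` A i \<inter> space M) \<inter> (Y i -` B i \<inter> space M)) =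
        ((\<lambda>\<omega>. \<lambda>i\<in>I. X i \<omega>) -` prod_emb I M1 J (Pi\<^sub>E J A) \<inter> space M) \<inter>
        ((\<lambda>\<omega>. \<lambda>i\<in>I. Y i \<omega>) -` prod_emb I M2 J (Pi\<^sub>E J B) \<inter> space M)"
      unfolding preX preY by (rule INT_Int_distrib)
    also have "prob \<dots> = prob ((\<lambda>\<omega>. \<lambda>i\<in>I. X i \<omega>) -` prod_emb I M1 J (Pi\<^sub>E J A) \<inter> space M) *
        prob ((\<lambda>\<omega>. \<lambda>i\<in>I. Y i \<omega>) -` prod_emb I M2 J (Pi\<^sub>E J B) \<inter> space M)"
      using J A B by (intro XY sets_PiM_I) auto
    also note preX
    also note preY
    also have "prob (\<Inter>i\<in>J. X i -` A i \<inter> space M) = (\<Prod>i\<in>J. prob (X i -` A i \<inter> space M))"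
      using J A by (intro indep_varsD[OF X]) auto
    also have "prob (\<Inter>i\<in>J. Y i -` B i \<inter> space M) = (\<Prod>i\<in>J. prob (Y i -` B i \<inter> space M))"
      using J B by (intro indep_varsD[OF Y]) auto
    finally show ?thesis
      by (simp only: prod.distrib)
  qed
  have "indep_sets E I"
  proof (rule indep_setsI)
    show "E i \<subseteq> events" if "i \<in> I" for i
      using rvX[OF that] rvY[OF that] by (auto simp: E_iff)
  next
    fix G J assume J: "J \<noteq> {}" "J \<subseteq> I" "finite J" and "\<forall>j\<in>J. G j \<in> E j"
    then have "\<forall>j\<in>J. \<exists>A B. A \<in> sets (M1 j) \<and> B \<in> sets (M2 j) \<and>
        G j = (X j -` A \<inter> space M) \<inter> (Y j -` B \<inter> space M)"
      by (simp add: E_iff)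
    then obtain A B where AB: "\<And>j. j \<in> J \<Longrightarrow> A j \<in> sets (M1 j)" "\<And>j. j \<in> J \<Longrightarrow> B j \<in> sets (M2 j)"
        "\<And>j. j \<in> J \<Longrightarrow> G j = (X j -` A j \<inter> space M) \<inter> (Y j -` B j \<inter> space M)"
      by metis
    have "prob (G j) = prob (X j -` A j \<inter> space M) * prob (Y j -` B j \<inter> space M)" if "j \<in> J" for j
      using joint[of "{j}" A B] AB that J by auto
    then show "prob (\<Inter>j\<in>J. G j) = (\<Prod>j\<in>J. prob (G j))"
      using joint[of J A B] AB J by simp
  qed
  moreover have "Int_stable (E i)" for i
    unfolding Int_stable_def
  proof (intro ballI)
    fix G H assume "G \<in> E i" "H \<in> E i"
    then obtain A B A' B' where "A \<in> sets (M1 i)" "B \<in> sets (M2 i)" "A' \<in> sets (M1 i)" "B' \<in> sets (M2 i)"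
      "G = (X i -` A \<inter> space M) \<inter> (Y i -` B \<inter> space M)"
      "H = (X i -` A' \<inter> space M) \<inter> (Y i -` B' \<inter> space M)"
      by (auto simp: E_iff)
    then show "G \<inter> H \<in> E i"
      unfolding E_iff by (intro exI[of _ "A \<inter> A'"] exI[of _ "B \<inter> B'"]) auto
  qed
  ultimately have "indep_sets (\<lambda>i. sigma_sets (space M) (E i)) I"
    by (rule indep_sets_sigma)
  \<comment> \<open>Taking preimages commutes with generating a sigma-algebra, so the rectangles
    behind \<open>E i\<close> generate everything the pair generates.\<close>
  moreover have "sigma_sets (space M) {(\<lambda>\<omega>. (X i \<omega>, Y i \<omega>)) -` C \<inter> space M | C. C \<in> sets (M1 i \<Otimes>\<^sub>M M2 i)} =
      sigma_sets (space M) (E i)" if "i \<in> I" for i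
  proof -
    let ?P = "{A \<times> B | A B. A \<in> sets (M1 i) \<and> B \<in> sets (M2 i)}"
    have vimage_Times: "(\<lambda>\<omega>. (X i \<omega>, Y i \<omega>)) -` (A \<times> B) \<inter> space M =
        (X i -` A \<inter> space M) \<inter> (Y i -` B \<inter> space M)" for A B
      by auto
    have "{(\<lambda>\<omega>. (X i \<omega>, Y i \<omega>)) -` C \<inter> space M | C. C \<in> sets (M1 i \<Otimes>\<^sub>M M2 i)} =
        sigma_sets (space M) {(\<lambda>\<omega>. (X i \<omega>, Y i \<omega>)) -` C \<inter> space M | C. C \<in> ?P}"
      unfolding sets_pair_measure
      using rvX[OF that, THEN measurable_space] rvY[OF that, THEN measurable_space]
      by (intro sigma_sets_vimage_commute) auto
    also have "{(\<lambda>\<omega>. (X i \<omega>, Y i \<omega>)) -` C \<inter> space M | C. C \<in> ?P} = E i"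
      unfolding E_def vimage_Times[symmetric] by blast
    moreover have "E i \<subseteq> Pow (space M)"
      by (auto simp: E_iff)
    ultimately show ?thesis
      by (simp only: sigma_sets_sigma_sets_eq)
  qed
  ultimately show ?thesis
    unfolding indep_vars_def using rvX rvY by (auto cong: indep_sets_cong)
qed

text \<open>Initial segments suffice: the indices missing from a finite \<open>J\<close> are filled
  with the whole space, which contributes the factor 1.\<close>

lemma (in prob_space) iid_natI:
  fixes Y :: "nat \<Rightarrow> 'a \<Rightarrow> 'b"
  assumes \<nu>: "prob_space \<nu>"
    and [measurable]: "\<And>n. Y n \<in> measurable M \<nu>"
    and prod: "\<And>m A. (\<And>n. A n \<in> sets \<nu>) \<Longrightarrow>
      prob {\<omega>\<in>space M. \<forall>n<m. Y n \<omega> \<in> A n} = (\<Prod>n<m. measure \<nu> (A n))"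
  shows "indep_vars (\<lambda>_. \<nu>) Y UNIV" and "distr M \<nu> (Y n) = \<nu>"
proof -
  interpret \<nu>: prob_space \<nu> by fact
  have *: "prob (\<Inter>j\<in>J. Y j -` A j \<inter> space M) = (\<Prod>j\<in>J. measure \<nu> (A j))"
    if J: "finite J" "J \<noteq> {}" and A: "\<And>j. j \<in> J \<Longrightarrow> A j \<in> sets \<nu>" for J A
  proof -
    obtain m where m: "J \<subseteq> {..<m}"
      using finite_nat_iff_bounded[of J] J by auto
    define A' where "A' j = (if j \<in> J then A j else space \<nu>)" for j
    have "(\<Inter>j\<in>J. Y j -` A j \<inter> space M) = {\<omega>\<in>space M. \<forall>j<m. Y j \<omega> \<in> A' j}"
      using m J assms(2)[THEN measurable_space] by (auto simp: A'_def)
    also have "prob \<dots> = (\<Prod>j<m. measure \<nu> (A' j))"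
      by (rule prod) (auto simp: A'_def A)
    also have "\<dots> = (\<Prod>j\<in>J. measure \<nu> (A' j))"
      using m by (intro prod.mono_neutral_right) (auto simp: A'_def \<nu>.prob_space)
    finally show ?thesis by (simp add: A'_def)
  qed
  have single: "prob (Y j -` A \<inter> space M) = measure \<nu> A" if "A \<in> sets \<nu>" for j A
    using *[of "{j}" "\<lambda>_. A"] that by simp
  show "indep_vars (\<lambda>_. \<nu>) Y UNIV"
    unfolding indep_vars_def2
  proof (intro conjI ballI indep_setsI)
    fix G J assume J: "J \<noteq> {}" "finite J" and "\<forall>j\<in>J. G j \<in> {Y j -` A \<inter> space M |A. A \<in> sets \<nu>}"
    then have "\<forall>j\<in>J. \<exists>A. A \<in> sets \<nu> \<and> G j = Y j -` A \<inter> space M" by auto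
    then obtain A where "\<And>j. j \<in> J \<Longrightarrow> A j \<in> sets \<nu>" "\<And>j. j \<in> J \<Longrightarrow> G j = Y j -` A j \<inter> space M"
      by metis
    then show "prob (\<Inter>j\<in>J. G j) = (\<Prod>j\<in>J. prob (G j))"
      using *[of J A] J by (simp add: single)
  qed auto
  show "distr M \<nu> (Y n) = \<nu>"
    by (rule measure_eqI) (auto simp: emeasure_distr emeasure_eq_measure \<nu>.emeasure_eq_measure single)
qed

section \<open>Geometric thinning of a marked i.i.d. sequence\<close>

text \<open>
  The thinned process is read off a sequence of marked inter-arrival times: \<open>w n\<close> consists of the
  \<open>n\<close>-th inter-arrival time and the flag telling whether the point ending it is kept.
\<close>

definition first_mark :: "(nat \<Rightarrow> real \<times> bool) \<Rightarrow> nat" where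
  "first_mark w = (LEAST n. snd (w n))"

definition waiting_time :: "(nat \<Rightarrow> real \<times> bool) \<Rightarrow> real" where
  "waiting_time w = (\<Sum>i\<le>first_mark w. fst (w i))"

text \<open>The shift by \<open>Suc (first_mark w)\<close> drops the marked entry as well, leaving
  the process restarted after the kept point.\<close>

definition after_mark :: "(nat \<Rightarrow> real \<times> bool) \<Rightarrow> nat \<Rightarrow> real \<times> bool" where
  "after_mark w = (\<lambda>n. w (n + Suc (first_mark w)))"

section \<open>Cutting a marked sequence at its marks\<close>

lemma first_mark_eq: "snd (w n) \<Longrightarrow> (\<And>i. i < n \<Longrightarrow> \<not> snd (w i)) \<Longrightarrow> first_mark w = n"
  unfolding first_mark_def by (rule Least_equality) (auto simp: not_less[symmetric])

text \<open>Without a mark the value of \<open>LEAST\<close> is unspecified, hence the premise;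
  \<open>AE_marked\<close> shows that it holds almost surely.\<close>

lemma
  assumes "\<exists>n. snd (w n)"
  shows first_mark_marked: "snd (w (first_mark w))"
    and first_mark_least: "i < first_mark w \<Longrightarrow> \<not> snd (w i)"
  using assms by (auto simp: first_mark_def intro: LeastI_ex dest: not_less_Least)

text \<open>The pathwise form of \<open>L = q \<phi> + (1 - q) \<phi> L\<close>: a mark on the first
  entry ends the wait, otherwise the wait begins anew on \<open>w\<close>.\<close>

lemma waiting_time_case_nat:
  assumes "\<exists>n. snd (w n)"
  shows "waiting_time (case_nat z w) = fst z + (if snd z then 0 else waiting_time w)"
proof (cases "snd z")
  case True
  then have "first_mark (case_nat z w) = 0"
    by (intro first_mark_eq) auto
  with True show ?thesis by (simp add: waiting_time_def)
next
  case False
  have "first_mark (case_nat z w) = Suc (first_mark w)"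
    using first_mark_marked[OF assms] first_mark_least[OF assms] False
    by (intro first_mark_eq) (auto split: nat.split)
  with False show ?thesis
    by (simp add: waiting_time_def sum.atMost_Suc_shift del: sum.atMost_Suc)
qed

text \<open>Cutting \<open>w\<close> after every mark yields blocks whose totals are the successive
  waiting times. Hence the kept points are exactly the partial sums of waiting times.\<close>

lemma marked_partial_sums:
  assumes ex: "\<And>j. \<exists>n. snd ((after_mark ^^ j) w n)"
  shows "{(\<Sum>i\<le>n. fst (w i)) | n. snd (w n)} =
    range (\<lambda>m. \<Sum>j\<le>m. waiting_time ((after_mark ^^ j) w))"
proof -
  define R where "R j = (after_mark ^^ j) w" for j
  \<comment> \<open>Block \<open>j\<close> occupies the indices of \<open>w\<close> from
    \<open>start j\<close> up to but excluding \<open>start (Suc j)\<close>; its length is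
    \<open>Suc (first_mark (R j))\<close> since it includes its marked last entry.\<close>
  define start where "start j = (\<Sum>i<j. Suc (first_mark (R i)))" for j
  have start_Suc: "start (Suc j) = start j + Suc (first_mark (R j))" for j
    by (simp add: start_def)
  have R_eq: "R j = (\<lambda>n. w (n + start j))" for j
  proof (induction j)
    case (Suc j)
    have "R (Suc j) = after_mark (R j)"
      by (simp add: R_def)
    also have "\<dots> = (\<lambda>n. R j (n + Suc (first_mark (R j))))"
      by (rule after_mark_def)
    also have "\<dots> = (\<lambda>n. w (n + start (Suc j)))"
      unfolding start_Suc by (subst Suc.IH) (simp add: algebra_simps)
    finally show ?case .
  qed (simp add: R_def start_def)
  have marked: "snd (w (first_mark (R j) + start j))"
    and unmarked: "i < first_mark (R j) \<Longrightarrow> \<not> snd (w (i + start j))" for i j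
    using first_mark_marked[of "R j"] first_mark_least[of "R j" i] ex[of j]
    by (simp_all add: R_eq flip: R_def)
  have sum_eq: "(\<Sum>j<m. waiting_time (R j)) = (\<Sum>i<start m. fst (w i))" for m
  proof (induction m)
    case (Suc m)
    have sum_add: "(\<Sum>i<a + b. fst (w i)) = (\<Sum>i<a. fst (w i)) + (\<Sum>i<b. fst (w (i + a)))" for a b
      by (induction b) (simp_all add: add.commute)
    have "(\<Sum>j<Suc m. waiting_time (R j)) = (\<Sum>i<start m. fst (w i)) + waiting_time (R m)"
      using Suc.IH by (simp only: sum.lessThan_Suc)
    also have "waiting_time (R m) = (\<Sum>i<Suc (first_mark (R m)). fst (w (i + start m)))"
      unfolding waiting_time_def lessThan_Suc_atMost by (simp add: R_eq)
    finally show ?case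
      by (simp only: start_Suc sum_add)
  qed (simp add: start_def)
  show ?thesis
  proof safe
    fix n assume n: "snd (w n)"
    have start_ge: "m \<le> start m" for m
      by (induction m) (auto simp: start_Suc)
    \<comment> \<open>The number of the block containing \<open>n\<close>; it exists because every
      block has at least one entry.\<close>
    define m where "m = (LEAST m. n < start (Suc m))"
    have m: "n < start (Suc m)"
      unfolding m_def by (rule LeastI[of _ n]) (use start_ge[of "Suc n"] in auto)
    have "start m \<le> n"
    proof (cases m)
      case (Suc m')
      then have "\<not> n < start (Suc m')"
        using not_less_Least[of m' "\<lambda>m. n < start (Suc m)"] by (simp add: m_def)
      with Suc show ?thesis by simp
    qed (simp add: start_def)
    \<comment> \<open>Within a block only the last entry is marked, so the marked index
      \<open>n\<close> must be that entry.\<close>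
    moreover from this have "\<not> n - start m < first_mark (R m)"
      using n unmarked[of "n - start m" m] by auto
    ultimately have "n = first_mark (R m) + start m"
      using m unfolding start_Suc by linarith
    then have "(\<Sum>i\<le>n. fst (w i)) = (\<Sum>j\<le>m. waiting_time (R j))"
      using sum_eq[of "Suc m"] by (simp only: start_Suc lessThan_Suc_atMost add.commute add_Suc_right)
    then show "(\<Sum>i\<le>n. fst (w i)) \<in> range (\<lambda>m. \<Sum>j\<le>m. waiting_time ((after_mark ^^ j) w))"
      by (simp add: R_def)
  next
    fix m
    show "\<exists>n. (\<Sum>j\<le>m. waiting_time ((after_mark ^^ j) w)) = (\<Sum>i\<le>n. fst (w i)) \<and> snd (w n)"
      using marked[of m] sum_eq[of "Suc m"] unfolding R_def[symmetric]
      by (intro exI[of _ "first_mark (R m) + start m"] conjI)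
        (simp_all only: start_Suc lessThan_Suc_atMost add.commute add_Suc_right)
  qed
qed

lemma measure_pair_measure_Times:
  assumes "sigma_finite_measure M2" "A \<in> sets M1" "B \<in> sets M2"
  shows "measure (M1 \<Otimes>\<^sub>M M2) (A \<times> B) = measure M1 A * measure M2 B"
  using assms by (simp add: measure_def sigma_finite_measure.emeasure_pair_measure_Times enn2real_mult)

section \<open>Measurability of the cutting operations\<close>

lemma first_mark_measurable[measurable]:
  "first_mark \<in> measurable (PiM UNIV (\<lambda>_. borel \<Otimes>\<^sub>M count_space UNIV)) (count_space UNIV)"
  unfolding first_mark_def[abs_def] by measurable

text \<open>\<open>first_mark\<close> takes countably many values, so it may be treated as a
  constant in the bound of the sum. The same device serves \<open>after_mark\<close>.\<close>

lemma waiting_time_measurable[measurable]: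
  "waiting_time \<in> borel_measurable (PiM UNIV (\<lambda>_. borel \<Otimes>\<^sub>M count_space UNIV))"
  unfolding waiting_time_def[abs_def]
  by (rule measurable_compose_countable[OF _ first_mark_measurable]) measurable

lemma after_mark_measurable[measurable]:
  "after_mark \<in> measurable (PiM UNIV (\<lambda>_. borel \<Otimes>\<^sub>M count_space UNIV))
     (PiM UNIV (\<lambda>_. borel \<Otimes>\<^sub>M count_space UNIV))"
  unfolding after_mark_def[abs_def]
proof (rule measurable_compose_countable[OF _ first_mark_measurable])
  show "(\<lambda>w n. w (n + Suc i)) \<in> measurable (PiM UNIV (\<lambda>_. borel \<Otimes>\<^sub>M count_space UNIV))
     (PiM UNIV (\<lambda>_. borel \<Otimes>\<^sub>M count_space UNIV :: (real \<times> bool) measure))" for i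
    by (rule measurable_PiM_single') (auto simp: space_PiM space_pair_measure)
qed

lemma funpow_after_mark_measurable[measurable]:
  "(after_mark ^^ j) \<in> measurable (PiM UNIV (\<lambda>_. borel \<Otimes>\<^sub>M count_space UNIV))
     (PiM UNIV (\<lambda>_. borel \<Otimes>\<^sub>M count_space UNIV))"
  by (induction j) (simp_all add: id_def measurable_comp[OF _ after_mark_measurable])

section \<open>The sequence space of marked inter-arrival times\<close>

locale geometric_thinning =
  fixes \<mu> :: "real measure" and q :: real
  assumes real_distribution: "real_distribution \<mu>"
    and pos: "AE x in \<mu>. 0 < x"
    and q: "0 < q" "q < 1"
begin

sublocale \<mu>: real_distribution \<mu>
  by (rule real_distribution)

definition D :: "(real \<times> bool) measure" where
  "D = \<mu> \<Otimes>\<^sub>M measure_pmf (bernoulli_pmf q)"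

lemma sets_D[measurable_cong]: "sets D = sets (borel \<Otimes>\<^sub>M count_space UNIV)"
  unfolding D_def by (intro sets_pair_measure_cong) auto

lemma space_D[simp]: "space D = UNIV"
  by (simp add: D_def space_pair_measure)

lemma prob_space_D: "prob_space D"
  unfolding D_def by (intro prob_space_pair \<mu>.prob_space_axioms prob_space_measure_pmf)

text \<open>Supplies \<open>S\<close>, the infinite product of \<open>D\<close>: the law of an
  i.i.d. sequence of marked inter-arrival times.\<close>

sublocale sequence_space D
  by (simp add: sequence_space_def product_prob_spaceI prob_space_D)

lemma space_S[simp]: "space S = UNIV"
  by (simp add: space_PiM)

lemma sets_S: "sets S = sets (PiM UNIV (\<lambda>_. borel \<Otimes>\<^sub>M count_space UNIV))"
  by (intro sets_PiM_cong sets_D refl)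

lemma
  shows waiting_time_measurable_S[measurable]: "waiting_time \<in> borel_measurable S"
    and funpow_after_mark_measurable_S[measurable]: "(after_mark ^^ j) \<in> measurable S S"
    and after_mark_measurable_S[measurable]: "after_mark \<in> measurable S S"
  by (simp_all add: measurable_cong_sets[OF sets_S refl] measurable_cong_sets[OF sets_S sets_S])

text \<open>Splitting off the first entry shows that the probability \<open>?x\<close> of never
  seeing a mark satisfies \<open>?x = (1 - q) * ?x\<close>, so it is 0.\<close>

lemma AE_marked: "AE w in S. \<exists>n. snd (w n)"
proof -
  let ?x = "measure S {w. \<forall>n. \<not> snd (w n)}"
  have [measurable]: "{w. \<forall>n. \<not> snd (w n)} \<in> sets S"
  proof -
    have "{w\<in>space S. \<forall>n. \<not> snd (w n)} \<in> sets S"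
      by measurable
    then show ?thesis by simp
  qed
  interpret D: prob_space D by (rule prob_space_D)
  have "?x = measure (D \<Otimes>\<^sub>M S) ((\<lambda>(z, w). case_nat z w) -` {w. \<forall>n. \<not> snd (w n)} \<inter> space (D \<Otimes>\<^sub>M S))"
    by (subst PiM_iter[symmetric], subst measure_distr) auto
  also have "(\<lambda>(z, w). case_nat z w) -` {w. \<forall>n. \<not> snd (w n)} \<inter> space (D \<Otimes>\<^sub>M S) =
      (UNIV \<times> {False}) \<times> {w. \<forall>n. \<not> snd (w n)}"
    by (auto simp: space_pair_measure split: nat.splits)
  also have "measure (D \<Otimes>\<^sub>M S) \<dots> = measure D (UNIV \<times> {False}) * ?x"
    by (rule measure_pair_measure_Times) (auto simp: P.sigma_finite_measure_axioms sets_D)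
  also have "measure D (UNIV \<times> {False}) = 1 - q"
    unfolding D_def using q
    using \<mu>.prob_space
    by (subst measure_pair_measure_Times) (auto simp: measure_pmf_single measure_pmf.sigma_finite_measure_axioms)
  finally have "?x = 0"
    using q by (simp add: algebra_simps)
  then show ?thesis
    by (subst AE_iff_measurable[OF _ refl]) (auto simp: P.emeasure_eq_measure)
qed

text \<open>Regeneration at the first mark: the future is independent of the wait and has law
  \<open>S\<close> again. The event is split by the value \<open>n\<close> of
  \<open>first_mark\<close>; on each piece the wait depends only on the entries up to
  \<open>n\<close>, and the future only on the later ones.\<close>

lemma measure_waiting_time_after_mark:
  assumes [measurable]: "A \<in> sets borel" "B \<in> sets S"
  shows "measure S {w. waiting_time w \<in> A \<and> after_mark w \<in> B} =
    measure S {w. waiting_time w \<in> A} * measure S B"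
proof -
  define C where "C n = {w\<in>space S. snd (w n) \<and> (\<forall>i<n. \<not> snd (w i)) \<and> (\<Sum>i\<le>n. fst (w i)) \<in> A}" for n
  define E where "E n B = {w\<in>space S. w \<in> C n \<and> after_mark w \<in> B}" for n B
  have C[measurable]: "C n \<in> sets S" for n
    unfolding C_def by measurable
  have E[measurable]: "E n B \<in> sets S" if [measurable]: "B \<in> sets S" for n B
    unfolding E_def by measurable
  have on_C: "first_mark w = n" if "w \<in> C n" for n w
    using that by (intro first_mark_eq) (auto simp: C_def)
  have prob_E: "measure S (E n B) = measure S (C n) * measure S B" if [measurable]: "B \<in> sets S" for n B
  proof -
    \<comment> \<open>\<open>S\<close> is also the law of the first \<open>Suc n\<close> entries of
      one sequence followed by an independent second one. When the first mark is at
      \<open>n\<close>, \<open>after_mark\<close> returns precisely that second sequence.\<close>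
    have "measure S (E n B) =
        measure (S \<Otimes>\<^sub>M S) ((\<lambda>(w, w'). comb_seq (Suc n) w w') -` E n B \<inter> space (S \<Otimes>\<^sub>M S))"
      by (subst PiM_comb_seq[symmetric, of "Suc n"], subst measure_distr) (auto intro: measurable_comb_seq)
    also have "(\<lambda>(w, w'). comb_seq (Suc n) w w') -` E n B \<inter> space (S \<Otimes>\<^sub>M S) = C n \<times> B"
    proof -
      have "comb_seq (Suc n) w w' \<in> C n \<longleftrightarrow> w \<in> C n" for w w'
        by (simp add: C_def comb_seq_def)
      moreover have "after_mark (comb_seq (Suc n) w w') = w'" if "w \<in> C n" for w w'
        using on_C[of "comb_seq (Suc n) w w'" n] calculation[of w w'] that
        by (simp add: after_mark_def comb_seq_def)
      ultimately show ?thesis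
        by (auto simp: E_def space_pair_measure)
    qed
    also have "measure (S \<Otimes>\<^sub>M S) \<dots> = measure S (C n) * measure S B"
      by (rule measure_pair_measure_Times) (auto simp: P.sigma_finite_measure_axioms)
    finally show ?thesis .
  qed
  have sums: "(\<lambda>n. measure S (E n B)) sums measure S {w. waiting_time w \<in> A \<and> after_mark w \<in> B}"
    if [measurable]: "B \<in> sets S" for B
  proof -
    have "(\<lambda>n. measure S (E n B)) sums measure S (\<Union>n. E n B)"
    proof (rule P.finite_measure_UNION)
      show "disjoint_family (\<lambda>n. E n B)"
        unfolding disjoint_family_on_def E_def using on_C by blast
    qed auto
    also have "measure S (\<Union>n. E n B) = measure S {w\<in>space S. waiting_time w \<in> A \<and> after_mark w \<in> B}"
    proof (rule P.finite_measure_eq_AE)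
      show "AE w in S. (w \<in> (\<Union>n. E n B)) = (w \<in> {w\<in>space S. waiting_time w \<in> A \<and> after_mark w \<in> B})"
        using AE_marked
      proof eventually_elim
        case (elim w)
        have "w \<in> C (first_mark w) \<longleftrightarrow> waiting_time w \<in> A"
          using first_mark_marked[OF elim] first_mark_least[OF elim]
          by (auto simp: C_def waiting_time_def)
        then show ?case
          using on_C by (fastforce simp: E_def)
      qed
    qed measurable
    finally show ?thesis by simp
  qed
  \<comment> \<open>The case \<open>B = UNIV\<close> identifies the total of the factors that do not
    involve \<open>B\<close>.\<close>
  have "(\<lambda>n. measure S (C n)) sums measure S {w. waiting_time w \<in> A}"
    using sums[of UNIV] sets.top[of S] by (simp add: E_def)
  then have "(\<lambda>n. measure S (C n) * measure S B) sums (measure S {w. waiting_time w \<in> A} * measure S B)"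
    by (rule sums_mult2)
  then show ?thesis
    using sums[of B] sums_unique2 by (simp add: prob_E)
qed

lemma distr_after_mark: "distr S S after_mark = S"
proof (rule measure_eqI)
  fix B assume "B \<in> sets (distr S S after_mark)"
  then have B: "B \<in> sets S" by simp
  have "measure S {w. after_mark w \<in> B} = measure S B"
    using measure_waiting_time_after_mark[of UNIV, OF _ B] P.prob_space by simp
  then show "emeasure (distr S S after_mark) B = emeasure S B"
    using B by (simp add: emeasure_distr P.emeasure_eq_measure vimage_def)
qed simp

text \<open>\<open>after_mark\<close> preserves \<open>S\<close>, so \<open>AE_marked\<close> passes
  to every iterate.\<close>

lemma AE_marked_after: "AE w in S. \<forall>j. \<exists>n. snd ((after_mark ^^ j) w n)"
proof -
  have "AE w in S. \<exists>n. snd ((after_mark ^^ j) w n)" for j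
  proof (induction j)
    case (Suc j)
    then have "AE w in distr S S after_mark. \<exists>n. snd ((after_mark ^^ j) w n)"
      by (simp only: distr_after_mark)
    from AE_distrD[OF after_mark_measurable_S this] show ?case
      by (simp add: funpow_Suc_right del: funpow.simps)
  qed (simp add: AE_marked)
  then show ?thesis
    by (simp add: AE_all_countable)
qed

section \<open>The law of the waiting times and its Laplace transform\<close>

definition waiting_law :: "real measure" where
  "waiting_law = distr S borel waiting_time"

lemma real_distribution_waiting_law: "real_distribution waiting_law"
  unfolding waiting_law_def by (rule P.real_distribution_distr) measurable

text \<open>Regeneration peels off the first waiting time; the others are waiting times of
  \<open>after_mark w\<close>, tested against the shifted sets. This is the premise that
  \<open>iid_natI\<close> asks for.\<close>

lemma waiting_times_product:
  assumes [measurable]: "\<And>n. A n \<in> sets borel"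
  shows "measure S {w. \<forall>n<m. waiting_time ((after_mark ^^ n) w) \<in> A n} =
    (\<Prod>n<m. measure waiting_law (A n))"
  using assms
proof (induction m arbitrary: A)
  case 0
  then show ?case using P.prob_space by simp
next
  case (Suc m)
  note [measurable] = Suc.prems
  let ?B = "{w. \<forall>n<m. waiting_time ((after_mark ^^ n) w) \<in> A (Suc n)}"
  have "{w\<in>space S. \<forall>n<m. waiting_time ((after_mark ^^ n) w) \<in> A (Suc n)} \<in> sets S"
    by measurable
  then have B: "?B \<in> sets S" by simp
  have "{w. \<forall>n<Suc m. waiting_time ((after_mark ^^ n) w) \<in> A n} =
      {w. waiting_time w \<in> A 0 \<and> after_mark w \<in> ?B}"
    by (auto simp: All_less_Suc2 funpow_Suc_right simp del: funpow.simps)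
  also have "measure S \<dots> = measure S {w. waiting_time w \<in> A 0} * measure S ?B"
    by (rule measure_waiting_time_after_mark) (use B in auto)
  also have "measure S {w. waiting_time w \<in> A 0} = measure waiting_law (A 0)"
    unfolding waiting_law_def by (subst measure_distr) (auto simp: vimage_def)
  also have "measure S ?B = (\<Prod>n<m. measure waiting_law (A (Suc n)))"
    by (rule Suc.IH) measurable
  finally show ?case
    by (simp add: prod.lessThan_Suc_shift del: prod.lessThan_Suc)
qed

lemma AE_pos: "AE w in S. \<forall>n. 0 < fst (w n)"
proof -
  interpret \<mu>\<beta>: pair_sigma_finite \<mu> "measure_pmf (bernoulli_pmf q)" ..
  have "AE z in \<mu> \<Otimes>\<^sub>M measure_pmf (bernoulli_pmf q). 0 < fst z"
  proof (rule \<mu>\<beta>.AE_pair_measure)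
    show "AE x in \<mu>. AE b in measure_pmf (bernoulli_pmf q). 0 < fst (x, b)"
      using pos by eventually_elim simp
  qed measurable
  then have "AE z in D. 0 < fst z"
    by (simp only: D_def)
  then show ?thesis
    by (subst AE_all_countable) (auto intro: AE_component)
qed

lemma AE_waiting_time_pos: "AE w in S. 0 < waiting_time w"
  using AE_pos
proof eventually_elim
  case (elim w)
  then show ?case
    unfolding waiting_time_def by (intro sum_pos) auto
qed

lemma AE_waiting_law_pos: "AE x in waiting_law. 0 < x"
  unfolding waiting_law_def using AE_waiting_time_pos by (subst AE_distr_iff) auto

text \<open>Integrating \<open>waiting_time_case_nat\<close> with Fubini over the first entry and
  the rest gives a linear equation for the transform, which is then solved.\<close>

lemma laplace_waiting_law:
  assumes "0 \<le> s"
  shows "laplace_transform waiting_law s =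
    q * laplace_transform \<mu> s / (1 - (1 - q) * laplace_transform \<mu> s)"
proof -
  interpret DS: pair_sigma_finite D S ..
  interpret \<mu>\<beta>: pair_sigma_finite \<mu> "measure_pmf (bernoulli_pmf q)" ..
  let ?L = "laplace_transform waiting_law s" and ?\<phi> = "laplace_transform \<mu> s"
  let ?f = "\<lambda>w. exp (- (s * waiting_time w))"
  \<comment> \<open>What is left after integrating out the tail: factor 1 if the first entry is
    marked, \<open>?L\<close> for a fresh wait otherwise.\<close>
  let ?g = "\<lambda>z. exp (- (s * fst z)) * (if snd z then 1 else ?L)"
  have L: "?L = (\<integral>w. ?f w \<partial>S)"
    unfolding laplace_transform_def waiting_law_def by (subst integral_distr) auto
  have "integrable S ?f"
    using integrable_laplace[OF nonneg_distributionI[OF real_distribution_waiting_law AE_waiting_law_pos] assms]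
    unfolding waiting_law_def by (subst (asm) integrable_distr_eq) auto
  then have f': "integrable (D \<Otimes>\<^sub>M S) (\<lambda>(z, w). ?f (case_nat z w))"
    by (subst (asm) PiM_iter[symmetric], subst (asm) integrable_distr_eq) (auto simp: split_beta')
  have inner: "(\<integral>w. ?f (case_nat z w) \<partial>S) = ?g z" for z
  proof -
    have "(\<integral>w. ?f (case_nat z w) \<partial>S) =
        (\<integral>w. exp (- (s * fst z)) * (if snd z then 1 else ?f w) \<partial>S)"
    proof (rule integral_cong_AE)
      show "AE w in S. ?f (case_nat z w) = exp (- (s * fst z)) * (if snd z then 1 else ?f w)"
        using AE_marked
        by eventually_elim (simp add: waiting_time_case_nat algebra_simps flip: exp_add)
    qed measurable
    then show ?thesis
      using L P.prob_space by simp
  qed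
  have "integrable D ?g"
    using DS.integrable_fst'[OF f'] by (simp add: inner)
  then have g: "integrable (\<mu> \<Otimes>\<^sub>M measure_pmf (bernoulli_pmf q)) ?g"
    by (simp only: D_def)
  have "?L = (\<integral>(z, w). ?f (case_nat z w) \<partial>(D \<Otimes>\<^sub>M S))"
    unfolding L by (subst PiM_iter[symmetric], subst integral_distr) (auto simp: split_beta')
  also have "\<dots> = (\<integral>z. ?g z \<partial>D)"
    using DS.integral_fst'[OF f'] by (simp add: inner)
  also have "\<dots> = (\<integral>x. (\<integral>b. ?g (x, b) \<partial>bernoulli_pmf q) \<partial>\<mu>)"
    unfolding D_def using \<mu>\<beta>.integral_fst'[OF g] by simp
  also have "\<dots> = (\<integral>x. exp (- (s * x)) * (q + ?L * (1 - q)) \<partial>\<mu>)"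
    using q by (simp add: algebra_simps)
  also have "\<dots> = ?\<phi> * (q + ?L * (1 - q))"
    by (simp add: laplace_transform_def)
  finally have "?L * (1 - (1 - q) * ?\<phi>) = q * ?\<phi>"
    by (simp add: algebra_simps)
  \<comment> \<open>The denominator is at least \<open>q\<close>, because
    \<open>?\<phi> \<le> 1\<close>.\<close>
  moreover have "1 - (1 - q) * ?\<phi> \<noteq> 0"
  proof -
    have "?\<phi> \<le> 1"
      using real_distribution pos assms by (intro laplace_le_1 nonneg_distributionI)
    then have "(1 - q) * ?\<phi> \<le> 1 - q"
      using q by (simp add: mult_left_le)
    then show ?thesis using q by linarith
  qed
  ultimately show ?thesis
    by (simp add: field_simps)
qed

end

section \<open>Components of a renewal process\<close>

lemma strict_mono_points:
  fixes t :: "nat \<Rightarrow> 'a \<Rightarrow> real"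
  assumes "\<And>n. 0 < interarrival t n \<omega>"
  shows "strict_mono (\<lambda>n. t n \<omega>)"
proof (rule strict_monoI_Suc)
  show "t n \<omega> < t (Suc n) \<omega>" for n
    using assms[of "Suc n"] by (simp add: interarrival_def)
qed

lemma sum_interarrival: "(\<Sum>i\<le>n. interarrival t i \<omega>) = t n \<omega>"
  by (induction n) (simp_all add: interarrival_def)

lemma interarrival_partial_sums: "interarrival (\<lambda>n \<omega>. \<Sum>i\<le>n. Y i \<omega>) = Y"
proof (intro ext)
  show "interarrival (\<lambda>n \<omega>. \<Sum>i\<le>n. Y i \<omega>) n \<omega> = Y n \<omega>" for n \<omega>
    by (cases n) (simp_all add: interarrival_def)
qed

lemma renewal_process_with_pointsD:
  assumes "prob_space M" "renewal_process_with_points M N t \<mu>"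
  shows "real_distribution \<mu>" "AE x in \<mu>. 0 < x"
proof -
  interpret prob_space M by fact
  have rv: "random_variable borel (interarrival t 0)" and \<mu>: "\<mu> = distr M borel (interarrival t 0)"
    and pos: "AE \<omega> in M. 0 < interarrival t 0 \<omega>"
    using assms(2) by (auto simp: renewal_process_with_points_def indep_vars_def2)
  show "real_distribution \<mu>"
    unfolding \<mu> by (rule real_distribution_distr[OF rv])
  show "AE x in \<mu>. 0 < x"
    unfolding \<mu> using pos rv by (subst AE_distr_iff) auto
qed

text \<open>The random set determines its least point, which is the first inter-arrival time, and
  the law of that is the inter-arrival distribution. This lets the computed law of a component stand
  for any law it may have.\<close>

lemma renewal_process_unique:
  assumes "prob_space M" "renewal_process M N \<mu>" "renewal_process M N \<nu>"
  shows "\<mu> = \<nu>"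
proof -
  interpret prob_space M by fact
  obtain s t where s: "renewal_process_with_points M N s \<mu>" and t: "renewal_process_with_points M N t \<nu>"
    using assms by (auto simp: renewal_process_def)
  have "AE \<omega> in M. N \<omega> = range (\<lambda>n. s n \<omega>)" "AE \<omega> in M. \<forall>n. 0 < interarrival s n \<omega>"
    "AE \<omega> in M. N \<omega> = range (\<lambda>n. t n \<omega>)" "AE \<omega> in M. \<forall>n. 0 < interarrival t n \<omega>"
    using s t by (simp_all add: renewal_process_with_points_def AE_all_countable)
  then have "AE \<omega> in M. interarrival s 0 \<omega> = interarrival t 0 \<omega>"
  proof eventually_elim
    case (elim \<omega>)
    have "strict_mono (\<lambda>n. s n \<omega>)" "strict_mono (\<lambda>n. t n \<omega>)"
      using elim by (auto intro: strict_mono_points)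
    then have "s 0 \<omega> \<le> s n \<omega>" "t 0 \<omega> \<le> t n \<omega>" for n
      by (auto dest: strict_mono_less_eq[of _ 0 n])
    \<comment> \<open>Each enumeration contains the first point of the other, so the two minima
      agree.\<close>
    moreover obtain i j where "s 0 \<omega> = t i \<omega>" "t 0 \<omega> = s j \<omega>"
      using elim by (metis rangeE rangeI)
    ultimately show ?case
      unfolding interarrival_def by (simp, metis order.antisym)
  qed
  then have "distr M borel (interarrival s 0) = distr M borel (interarrival t 0)"
    using s t by (intro distr_cong_AE) (auto simp: renewal_process_with_points_def indep_vars_def2)
  then show ?thesis
    using s t by (simp add: renewal_process_with_points_def)
qed

text \<open>The marked sequence \<open>W\<close> built on \<open>M\<close> has law \<open>S\<close>,
  so the results on the sequence space pull back along it. Only the flag \<open>X n = k\<close>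
  matters, so both components are covered, with \<open>q = p\<close> or
  \<open>q = 1 - p\<close>.\<close>

lemma renewal_process_component:
  assumes M: "prob_space M"
    and N: "renewal_process_with_points M N t \<mu>"
    and X: "prob_space.indep_vars M (\<lambda>_. count_space UNIV) X UNIV"
    and X_eq: "\<And>n. measure M {\<omega>\<in>space M. X n \<omega> = k} = q"
    and q: "0 < q" "q < 1"
    and indep: "indep_processes M t X"
  obtains \<nu> where "renewal_process M (component t X k) \<nu>" "nonneg_distribution \<nu>"
    "\<And>s. 0 \<le> s \<Longrightarrow> laplace_transform \<nu> s =
      q * laplace_transform \<mu> s / (1 - (1 - q) * laplace_transform \<mu> s)"
proof -
  interpret geometric_thinning \<mu> q
    using renewal_process_with_pointsD[OF M N] q by (intro geometric_thinning.intro)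
  interpret prob_space M by fact
  define T where "T = interarrival t"
  define B where "B n \<omega> \<longleftrightarrow> X n \<omega> = k" for n \<omega>
  define W where "W \<omega> n = (T n \<omega>, B n \<omega>)" for \<omega> n
  have T_indep: "indep_vars (\<lambda>_. borel) T UNIV" and T_law: "\<And>n. distr M borel (T n) = \<mu>"
    using N by (simp_all add: renewal_process_with_points_def T_def)
  have B_indep: "indep_vars (\<lambda>_. count_space UNIV) B UNIV"
    unfolding B_def by (rule indep_vars_compose2[OF X]) simp
  have [measurable]: "random_variable borel (T n)" "random_variable (count_space UNIV) (B n)" for n
    using T_indep B_indep by (auto simp: indep_vars_def2)
  have B_law: "distr M (count_space UNIV) (B n) = measure_pmf (bernoulli_pmf q)" for n
  proof (rule measure_eqI_countable[where A=UNIV])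
    have kept: "prob {\<omega>\<in>space M. B n \<omega>} = q"
      using X_eq[of n] by (simp add: B_def)
    have dropped: "prob {\<omega>\<in>space M. \<not> B n \<omega>} = 1 - q"
      using prob_neg[of "B n"] kept by simp
    show "emeasure (distr M (count_space UNIV) (B n)) {b} = emeasure (measure_pmf (bernoulli_pmf q)) {b}" for b
      using kept dropped q
      by (cases b) (simp_all add: emeasure_distr emeasure_eq_measure vimage_def Int_def conj_commute
          emeasure_pmf_single)
  qed auto
  \<comment> \<open>\<open>T\<close> and \<open>B\<close> are measurable images of the whole
    sequences \<open>t\<close> and \<open>X\<close>, so they inherit independence, in the form that
    \<open>indep_vars_Pair\<close> expects.\<close>
  have TB: "prob (((\<lambda>\<omega>. \<lambda>n\<in>UNIV. T n \<omega>) -` A \<inter> space M) \<inter> ((\<lambda>\<omega>. \<lambda>n\<in>UNIV. B n \<omega>) -` C \<inter> space M)) =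
      prob ((\<lambda>\<omega>. \<lambda>n\<in>UNIV. T n \<omega>) -` A \<inter> space M) * prob ((\<lambda>\<omega>. \<lambda>n\<in>UNIV. B n \<omega>) -` C \<inter> space M)"
    if A: "A \<in> sets (PiM UNIV (\<lambda>_. borel))" and C: "C \<in> sets (PiM UNIV (\<lambda>_. count_space UNIV))" for A C
  proof -
    let ?f = "\<lambda>x :: nat \<Rightarrow> real. \<lambda>n. if n = 0 then x 0 else x n - x (n - 1)"
    \<comment> \<open>\<open>indep_var\<close> wants both variables in one value type, so \<open>indep_processes\<close> coerces \<open>X\<close> to reals.\<close>
    let ?g = "\<lambda>x :: nat \<Rightarrow> real. \<lambda>n. x n = real k"
    have "?f \<in> measurable (PiM UNIV (\<lambda>_. borel)) (PiM UNIV (\<lambda>_. borel))"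
      by (rule measurable_PiM_single') (auto simp: space_PiM)
    from measurable_sets[OF this A] have f: "?f -` A \<in> sets (PiM UNIV (\<lambda>_. borel))"
      by (simp add: space_PiM)
    have "?g \<in> measurable (PiM UNIV (\<lambda>_. count_space UNIV)) (PiM UNIV (\<lambda>_. count_space UNIV))"
      by (rule measurable_PiM_single') (auto simp: space_PiM)
    from measurable_sets[OF this C] have g: "?g -` C \<in> sets (PiM UNIV (\<lambda>_. count_space UNIV))"
      by (simp add: space_PiM)
    have "(\<lambda>\<omega>. \<lambda>n\<in>UNIV. T n \<omega>) -` A \<inter> space M = (\<lambda>\<omega> n. t n \<omega>) -` (?f -` A) \<inter> space M"
      "(\<lambda>\<omega>. \<lambda>n\<in>UNIV. B n \<omega>) -` C \<inter> space M = (\<lambda>\<omega> n. real (X n \<omega>)) -` (?g -` C) \<inter> space M"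
      by (simp_all add: T_def interarrival_def B_def vimage_def restrict_def)
    moreover have "(\<lambda>\<omega>. (\<lambda>n. t n \<omega>, \<lambda>n. real (X n \<omega>))) -` (?f -` A \<times> ?g -` C) \<inter> space M =
        ((\<lambda>\<omega> n. t n \<omega>) -` (?f -` A) \<inter> space M) \<inter> ((\<lambda>\<omega> n. real (X n \<omega>)) -` (?g -` C) \<inter> space M)"
      by (rule set_eqI) (simp only: vimage_eq mem_Times_iff fst_conv snd_conv Int_iff, argo)
    ultimately show ?thesis
      using indep_varD[OF indep[unfolded indep_processes_def] f g] by (simp only:)
  qed
  have pair_law: "distr M (borel \<Otimes>\<^sub>M count_space UNIV) (\<lambda>\<omega>. (T n \<omega>, B n \<omega>)) = D" for n
    unfolding D_def
  proof (rule pair_measure_eqI[symmetric])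
    fix A C assume "A \<in> sets \<mu>" "C \<in> sets (measure_pmf (bernoulli_pmf q))"
    then have [measurable]: "A \<in> sets borel" by simp
    have "prob {\<omega>\<in>space M. T n \<omega> \<in> A \<and> B n \<omega> \<in> C} =
        prob {\<omega>\<in>space M. T n \<omega> \<in> A} * prob {\<omega>\<in>space M. B n \<omega> \<in> C}"
    proof -
      have "{x\<in>space (PiM UNIV (\<lambda>_. borel)). x n \<in> A} \<in> sets (PiM UNIV (\<lambda>_. borel :: real measure))"
        "{x\<in>space (PiM UNIV (\<lambda>_. count_space UNIV)). x n \<in> C} \<in> sets (PiM UNIV (\<lambda>_. count_space UNIV :: bool measure))"
        by measurable
      from TB[OF this] show ?thesis
        by (simp add: space_PiM vimage_def Int_def conj_ac)
    qed
    moreover have "emeasure \<mu> A = prob {\<omega>\<in>space M. T n \<omega> \<in> A}"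
      unfolding T_law[of n, symmetric]
      by (simp add: emeasure_distr emeasure_eq_measure vimage_def Int_def conj_commute)
    moreover have "emeasure (measure_pmf (bernoulli_pmf q)) C = prob {\<omega>\<in>space M. B n \<omega> \<in> C}"
      unfolding B_law[of n, symmetric]
      by (simp add: emeasure_distr emeasure_eq_measure vimage_def Int_def conj_commute)
    moreover have "emeasure (distr M (borel \<Otimes>\<^sub>M count_space UNIV) (\<lambda>\<omega>. (T n \<omega>, B n \<omega>))) (A \<times> C) =
        prob {\<omega>\<in>space M. T n \<omega> \<in> A \<and> B n \<omega> \<in> C}"
      by (subst emeasure_distr) (auto simp: emeasure_eq_measure intro!: arg_cong[where f=prob])
    ultimately show "emeasure \<mu> A * emeasure (measure_pmf (bernoulli_pmf q)) C =
        emeasure (distr M (borel \<Otimes>\<^sub>M count_space UNIV) (\<lambda>\<omega>. (T n \<omega>, B n \<omega>))) (A \<times> C)"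
      by (simp add: ennreal_mult)
  qed (auto simp: \<mu>.sigma_finite_measure_axioms measure_pmf.sigma_finite_measure_axioms sets_D[unfolded D_def])
  have "indep_vars (\<lambda>_. borel \<Otimes>\<^sub>M count_space UNIV) (\<lambda>n \<omega>. (T n \<omega>, B n \<omega>)) UNIV"
    by (rule indep_vars_Pair[OF T_indep B_indep TB])
  \<comment> \<open>Independent pairs, each of law \<open>D\<close>, have the product measure as
    their joint law.\<close>
  then have W_law: "distr M (PiM UNIV (\<lambda>_. borel \<Otimes>\<^sub>M count_space UNIV)) W = S"
    by (subst (asm) indep_vars_iff_distr_eq_PiM') (simp_all add: pair_law W_def[abs_def] restrict_def)
  have W[measurable]: "W \<in> measurable M S"
    unfolding measurable_cong_sets[OF refl sets_S] W_def[abs_def]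
    by (rule measurable_PiM_single') (auto simp: space_pair_measure)
  have W_S: "distr M S W = S"
    using W_law sets_S by (metis distr_cong)
  have AE_W: "AE \<omega> in M. P (W \<omega>)" if "AE w in S. P w" for P
    using that by (subst (asm) W_S[symmetric]) (rule AE_distrD[OF W])
  define Y where "Y n \<omega> = waiting_time ((after_mark ^^ n) (W \<omega>))" for n \<omega>
  have [measurable]: "random_variable borel (Y n)" for n
    unfolding Y_def[abs_def] by measurable
  have Y_prod: "prob {\<omega>\<in>space M. \<forall>n<m. Y n \<omega> \<in> A n} = (\<Prod>n<m. measure waiting_law (A n))"
    if A: "\<And>n. A n \<in> sets waiting_law" for m A
  proof -
    have [measurable]: "A n \<in> sets borel" for n
      using A[of n] by (simp add: waiting_law_def)
    have "{w\<in>space S. \<forall>n<m. waiting_time ((after_mark ^^ n) w) \<in> A n} \<in> sets S"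
      by measurable
    then have "prob {\<omega>\<in>space M. \<forall>n<m. Y n \<omega> \<in> A n} =
        measure (distr M S W) {w. \<forall>n<m. waiting_time ((after_mark ^^ n) w) \<in> A n}"
      by (subst measure_distr) (auto simp: Y_def intro: arg_cong[where f=prob])
    also have "\<dots> = (\<Prod>n<m. measure waiting_law (A n))"
      unfolding W_S by (rule waiting_times_product) measurable
    finally show ?thesis .
  qed
  interpret waiting: real_distribution waiting_law
    by (rule real_distribution_waiting_law)
  \<comment> \<open>\<open>iid_natI\<close> takes the law itself as value space; its sigma-algebra
    is the Borel one, so its conclusions carry over to \<open>borel\<close>.\<close>
  have meas_eq: "measurable M waiting_law = measurable M borel"
    by (intro measurable_cong_sets) auto
  have "indep_vars (\<lambda>_. waiting_law) Y UNIV"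
    by (rule iid_natI[OF waiting.prob_space_axioms _ Y_prod]) (simp add: meas_eq)
  then have Y_indep: "indep_vars (\<lambda>_. borel) Y UNIV"
    by (simp add: indep_vars_def2 meas_eq)
  have Y_law: "distr M borel (Y n) = waiting_law" for n
  proof -
    have "distr M waiting_law (Y n) = waiting_law"
      by (rule iid_natI[OF waiting.prob_space_axioms _ Y_prod]) (simp add: meas_eq)
    then show ?thesis
      by (metis distr_cong waiting.events_eq_borel)
  qed
  have Y_pos: "AE \<omega> in M. 0 < Y n \<omega>" for n
    using AE_waiting_law_pos unfolding Y_law[of n, symmetric] by (subst (asm) AE_distr_iff) auto
  have "AE \<omega> in M. component t X k \<omega> = range (\<lambda>m. \<Sum>j\<le>m. Y j \<omega>)"
    using AE_W[OF AE_marked_after]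
  proof eventually_elim
    case (elim \<omega>)
    have "component t X k \<omega> = {(\<Sum>i\<le>n. fst (W \<omega> i)) | n. snd (W \<omega> n)}"
      by (simp add: component_def W_def T_def B_def sum_interarrival)
    with marked_partial_sums[of "W \<omega>"] elim show ?case
      by (simp add: Y_def)
  qed
  then have "renewal_process M (component t X k) waiting_law"
    unfolding renewal_process_def renewal_process_with_points_def
    using Y_indep Y_law Y_pos
    by (intro exI[of _ "\<lambda>n \<omega>. \<Sum>i\<le>n. Y i \<omega>"]) (simp add: interarrival_partial_sums)
  then show thesis
    using nonneg_distributionI[OF real_distribution_waiting_law AE_waiting_law_pos] laplace_waiting_law
    by (rule that)
qed

theorem mainTheorem3:
  fixes M :: "'a measure"
    and N :: "'a \<Rightarrow> real set"
    and t :: "nat \<Rightarrow> 'a \<Rightarrow> real"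
    and \<mu> :: "real measure"
    and X :: "real \<Rightarrow> nat \<Rightarrow> 'a \<Rightarrow> nat"
  assumes "prob_space M"
    and "renewal_process_with_points M N t \<mu>"
    and "\<And>p. 0 < p \<Longrightarrow> p < 1 \<Longrightarrow> bernoulli_process M p (X p)"
    and "\<And>p. 0 < p \<Longrightarrow> p < 1 \<Longrightarrow> indep_processes M t (X p)"
  shows "((\<exists>p. 0 < p \<and> p < 1 \<and>
             (\<exists>\<mu>1. renewal_process M (component t (X p) 1) \<mu>1 \<and> same_type \<mu>1 \<mu>))
           \<longleftrightarrow> semi_mittag_leffler \<mu>) \<and>
         ((\<exists>p. 0 < p \<and> p < 1 \<and>
             (\<exists>\<mu>2. renewal_process M (component t (X p) 2) \<mu>2 \<and> same_type \<mu>2 \<mu>))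
           \<longleftrightarrow> semi_mittag_leffler \<mu>)"
proof -
  note \<mu> = renewal_process_with_pointsD[OF assms(1,2)]
  note nonneg = nonneg_distributionI[OF \<mu>]
  let ?\<phi> = "laplace_transform \<mu>"
  let ?inv = "\<lambda>q. \<exists>c>0. \<forall>s\<ge>0. q * ?\<phi> s / (1 - (1 - q) * ?\<phi> s) = ?\<phi> (c * s)"
  \<comment> \<open>Here \<open>q\<close> is the probability that component \<open>k\<close> keeps a
    point. By uniqueness the existential over laws reduces to the one computed law, leaving an
    equation for \<open>?\<phi>\<close> alone.\<close>
  have same_type_iff: "(\<exists>\<nu>. renewal_process M (component t (X p) k) \<nu> \<and> same_type \<nu> \<mu>) \<longleftrightarrow> ?inv q"
    if p: "0 < p" "p < 1" and q: "0 < q" "q < 1"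
      and X_eq: "\<And>n. measure M {\<omega>\<in>space M. X p n \<omega> = k} = q" for p q k
  proof -
    have "prob_space.indep_vars M (\<lambda>_. count_space UNIV) (X p) UNIV"
      using assms(3)[OF p] by (simp add: bernoulli_process_def)
    then obtain \<nu> where \<nu>: "renewal_process M (component t (X p) k) \<nu>" "nonneg_distribution \<nu>"
        "\<And>s. 0 \<le> s \<Longrightarrow> laplace_transform \<nu> s = q * ?\<phi> s / (1 - (1 - q) * ?\<phi> s)"
      using renewal_process_component[OF assms(1,2) _ X_eq q assms(4)[OF p]] by blast
    have "(\<exists>\<nu>'. renewal_process M (component t (X p) k) \<nu>' \<and> same_type \<nu>' \<mu>) \<longleftrightarrow> same_type \<nu> \<mu>"
      using \<nu>(1) renewal_process_unique[OF assms(1)] by blast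
    also have "\<dots> \<longleftrightarrow> ?inv q"
      using \<nu>(2,3) nonneg by (auto simp: same_type_def)
    finally show ?thesis .
  qed
  have X_eq: "measure M {\<omega>\<in>space M. X p n \<omega> = 1} = p" "measure M {\<omega>\<in>space M. X p n \<omega> = 2} = 1 - p"
    if "0 < p" "p < 1" for p n
    using assms(3)[OF that] by (simp_all add: bernoulli_process_def)
  note iff = semi_mittag_leffler_iff_thinning_invariant[OF nonneg \<mu>(2)]
  have "(\<exists>p. 0 < p \<and> p < 1 \<and> (\<exists>\<nu>. renewal_process M (component t (X p) 1) \<nu> \<and> same_type \<nu> \<mu>))
      \<longleftrightarrow> (\<exists>p. 0 < p \<and> p < 1 \<and> ?inv p)"
    using same_type_iff X_eq(1) by (intro ex_cong1 conj_cong refl) auto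
  moreover have "(\<exists>p. 0 < p \<and> p < 1 \<and> (\<exists>\<nu>. renewal_process M (component t (X p) 2) \<nu> \<and> same_type \<nu> \<mu>))
      \<longleftrightarrow> (\<exists>p. 0 < p \<and> p < 1 \<and> ?inv (1 - p))"
    using same_type_iff[of _ "1 - _" 2] X_eq(2) by (intro ex_cong1 conj_cong refl) auto
  \<comment> \<open>The second component keeps points with probability \<open>1 - p\<close>, and
    this substitution maps the open unit interval onto itself.\<close>
  moreover have "(\<exists>p. 0 < p \<and> p < 1 \<and> ?inv (1 - p)) \<longleftrightarrow> (\<exists>p. 0 < p \<and> p < 1 \<and> ?inv p)"
  proof
    assume "\<exists>p. 0 < p \<and> p < 1 \<and> ?inv (1 - p)"
    then obtain p where "0 < p" "p < 1" "?inv (1 - p)" by blast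
    then show "\<exists>p. 0 < p \<and> p < 1 \<and> ?inv p"
      by (intro exI[of _ "1 - p"]) simp
  next
    assume "\<exists>p. 0 < p \<and> p < 1 \<and> ?inv p"
    then obtain p where "0 < p" "p < 1" "?inv p" by blast
    then show "\<exists>p. 0 < p \<and> p < 1 \<and> ?inv (1 - p)"
      by (intro exI[of _ "1 - p"]) simp
  qed
  ultimately show ?thesis
    unfolding iff by (simp only: simp_thms)
qed

end
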